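(* Let $A\in\mathbb{R}^{m\times n}$ have rows $\boldsymbol a_1^T,\dots,\boldsymbol a_m^T$, let $\boldsymbol c\in\mathbb{R}^n$ with $\lVert\boldsymbol c\rVert=1$, and consider the linear program $$(\mathrm P)\qquad \max\{\boldsymbol c^T\boldsymbol x: A\boldsymbol x\le \mathbf 1\}.$$ Let $\mathcal Q:=\operatorname{conv}\{\boldsymbol 0,\boldsymbol a_1,\dots,\boldsymbol a_m\}$ and $\rho^*:=\max\{\rho\ge 0:\rho\boldsymbol c\in\mathcal Q\}$. Then exactly one of the following holds. 1. If $\rho^*>0$, then $(\mathrm P)$ has the finite optimal value $$\max\{\boldsymbol c^T\boldsymbol x:A\boldsymbol x\le\mathbf 1\}=\frac1{\rho^*}.$$ Define $\boldsymbol q^*:=\rho^*\boldsymbol c$. If $\boldsymbol d^T\boldsymbol q\le\boldsymbol d^T\boldsymbol q^*$ supports $\mathcal Q$ at $\boldsymbol q^*$ (i.e. the inequality holds for all $\boldsymbol q\in\mathcal Q$), with $\boldsymbol d^T\boldsymbol q^*>0$, then $$\boldsymbol x^*:=\frac{\boldsymbol d}{\boldsymbol d^T\boldsymbol q^*}$$ is optimal for $(\mathrm P)$. If $\boldsymbol q^*=\sum_{i=1}^m\lambda_i\boldsymbol a_i$ with $\lambda_i\ge0$ and $\sum_{i=1}^m\lambda_i=1$, define $u_i^*:=\lambda_i/\rho^*$ for $i=1,\dots,m$. Then, for any such $\boldsymbol d$ and weights $\lambda_i$, $(\boldsymbol x^*,\boldsymbol u^* )$ is a primal--dual optimum for $(\mathrm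 P)$. 2. If $\rho^*=0$, then $(\mathrm P)$ is unbounded above. Moreover, a vector $\boldsymbol d$ satisfying $\boldsymbol d^T\boldsymbol q\le0$ for every $\boldsymbol q\in\mathcal Q$ and $\boldsymbol d^T\boldsymbol c>0$ gives the recession direction $\boldsymbol r:=\boldsymbol d/(\boldsymbol c^T\boldsymbol d)$, for which $A\boldsymbol r\le\boldsymbol 0$ and $\boldsymbol c^T\boldsymbol r=1$.
   Context: $\lVert\cdot\rVert$ is the Euclidean norm and $\mathbf 1$ the all-ones vector; vector inequalities are componentwise. The problem $(\mathrm P)$ arises from an LP $\max\{(\boldsymbol c^0)^T\boldsymbol x^0:A^0\boldsymbol x^0\le\boldsymbol b^0\}$ with $\boldsymbol c^0\neq\boldsymbol 0$ and a known strictly feasible point by translating that point to the origin, dividing each row by its positive slack, and normalizing the objective. The maximum defining $\rho^*$ exists because $\mathcal Q$ is compact and contains $\boldsymbol 0$. The (normalized) dual of $(\mathrm P)$ is $\min\{\mathbf 1^T\boldsymbol u:A^T\boldsymbol u=\boldsymbol c,\ \boldsymbol u\ge\boldsymbol 0\}$; a primal--dual optimum is a pair consisting of an optimal solution of $(\mathrm P)$ and an optimal solution of this dual (with equal objective values). *)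

theory Defs
  imports "HOL-Analysis.Analysis"
begin

definition is_maximum :: "real set \<Rightarrow> real \<Rightarrow> bool" where
  "is_maximum S v \<longleftrightarrow> v \<in> S \<and> (\<forall>w\<in>S. w \<le> v)"

text \<open>On \<^typ>\<open>real ^ 'k\<close> the order is componentwise, and the constant \<open>1\<close> is the all-ones vector.\<close>

definition primal_feasible :: "real ^ 'n ^ 'm \<Rightarrow> (real ^ 'n) set" where
  "primal_feasible A = {x. A *v x \<le> 1}"

definition primal_optimal :: "real ^ 'n ^ 'm \<Rightarrow> real ^ 'n \<Rightarrow> real ^ 'n \<Rightarrow> bool" where
  "primal_optimal A c x \<longleftrightarrow>
     x \<in> primal_feasible A \<and> (\<forall>y \<in> primal_feasible A. c \<bullet> y \<le> c \<bullet> x)"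

definition dual_feasible :: "real ^ 'n ^ 'm \<Rightarrow> real ^ 'n \<Rightarrow> (real ^ 'm) set" where
  "dual_feasible A c = {u. transpose A *v u = c \<and> 0 \<le> u}"

definition dual_optimal :: "real ^ 'n ^ 'm \<Rightarrow> real ^ 'n \<Rightarrow> real ^ 'm \<Rightarrow> bool" where
  "dual_optimal A c u \<longleftrightarrow>
     u \<in> dual_feasible A c \<and> (\<forall>v \<in> dual_feasible A c. 1 \<bullet> u \<le> 1 \<bullet> v)"

definition primal_dual_optimum ::
    "real ^ 'n ^ 'm \<Rightarrow> real ^ 'n \<Rightarrow> real ^ 'n \<Rightarrow> real ^ 'm \<Rightarrow> bool" where
  "primal_dual_optimum A c x u \<longleftrightarrow>
     primal_optimal A c x \<and> dual_optimal A c u \<and> c \<bullet> x = 1 \<bullet> u"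

definition recession_direction :: "(real ^ 'n) set \<Rightarrow> real ^ 'n \<Rightarrow> bool" where
  "recession_direction S r \<longleftrightarrow> r \<noteq> 0 \<and> (\<forall>x\<in>S. \<forall>t\<ge>0. x + t *\<^sub>R r \<in> S)"

definition row_hull :: "real ^ 'n ^ 'm \<Rightarrow> (real ^ 'n) set" where
  "row_hull A = convex hull (insert 0 (rows A))"

text \<open>The maximum is attained whenever \<open>c \<noteq> 0\<close>; see \<open>rho_star_is_maximum\<close> below.\<close>

definition rho_star :: "real ^ 'n ^ 'm \<Rightarrow> real ^ 'n \<Rightarrow> real" where
  "rho_star A c = (GREATEST \<rho>. 0 \<le> \<rho> \<and> \<rho> *\<^sub>R c \<in> row_hull A)"

lemma compact_row_hull: "compact (row_hull A)"
proof -
  have "rows A = range (\<lambda>i. row i A)"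
    by (auto simp: rows_def)
  then have "finite (insert 0 (rows A))"
    by simp
  then show ?thesis
    unfolding row_hull_def by (rule finite_imp_compact_convex_hull)
qed

lemma rho_star_is_maximum:
  fixes A :: "real ^ 'n ^ 'm" and c :: "real ^ 'n"
  assumes "c \<noteq> 0"
  shows "is_maximum {\<rho>. 0 \<le> \<rho> \<and> \<rho> *\<^sub>R c \<in> row_hull A} (rho_star A c)"
proof -
  let ?S = "{\<rho>. 0 \<le> \<rho> \<and> \<rho> *\<^sub>R c \<in> row_hull A}"
  have "closed ((\<lambda>\<rho>. \<rho> *\<^sub>R c) -` row_hull A)"
    by (intro closed_vimage compact_imp_closed compact_row_hull continuous_intros)
  moreover have "?S = {0..} \<inter> (\<lambda>\<rho>. \<rho> *\<^sub>R c) -` row_hull A"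
    by auto
  ultimately have cl: "closed ?S"
    by (metis closed_Int closed_real_atLeast)
  obtain B where B: "\<And>q. q \<in> row_hull A \<Longrightarrow> norm q \<le> B"
    using compact_imp_bounded[OF compact_row_hull] by (meson bounded_iff)
  have "norm \<rho> \<le> B / norm c" if "\<rho> \<in> ?S" for \<rho>
    using B[of "\<rho> *\<^sub>R c"] that assms by (simp add: field_simps)
  then have "bounded ?S"
    by (meson bounded_iff)
  with cl have "compact ?S"
    by (simp add: compact_eq_bounded_closed)
  moreover have "0 \<in> ?S"
    by (simp add: row_hull_def hull_inc)
  ultimately obtain s where s: "s \<in> ?S" "\<forall>t\<in>?S. t \<le> s"
    using compact_attains_sup[of ?S] by blast
  then have "rho_star A c = s"
    unfolding rho_star_def by (intro Greatest_equality) auto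
  with s show ?thesis
    by (simp add: is_maximum_def)
qed

end

theory Submission
  imports Defs
begin

text \<open>A point \<open>x\<close> is feasible iff \<open>x \<bullet> q \<le> 1\<close> on \<open>row_hull A\<close>, i.e. the feasible set is
  the polar of the hull; evaluating at \<open>\<rho> *\<^sub>R c\<close> bounds the value by \<open>1 / \<rho>\<close>. Conversely, if the ray
  through \<open>c\<close> leaves the hull at or before \<open>t *\<^sub>R c\<close>, then \<open>t *\<^sub>R c\<close> is not in the finitely generated,
  hence closed, convex cone spanned by the hull translated by \<open>- t *\<^sub>R c\<close>. Separating it from this cone
  gives a feasible point of value exactly \<open>1 / t\<close>. Take \<open>t = \<rho>\<close> if \<open>\<rho> > 0\<close> and
  arbitrarily small \<open>t > 0\<close> if \<open>\<rho> = 0\<close>.\<close>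

text \<open>A hyperplane that merely supports the hull at \<open>q\<close> may pass through the
  origin, giving only \<open>d \<bullet> q = 0\<close>. Strictly separating \<open>q\<close> from
  the cone generated by the translated hull rules this out. Membership of \<open>q\<close> in the
  hull is not assumed, so \<open>q\<close> may also lie beyond the exit point of its ray.\<close>

lemma polytope_exit_support:
  fixes S :: "'a::euclidean_space set"
  assumes "finite S" "S \<noteq> {}" "q \<noteq> 0"
    and exit: "\<And>t. t > 1 \<Longrightarrow> t *\<^sub>R q \<notin> convex hull S"
  obtains d where "\<And>y. y \<in> convex hull S \<Longrightarrow> d \<bullet> y \<le> d \<bullet> q" "d \<bullet> q > 0"
proof -
  let ?K = "convex_cone hull ((\<lambda>s. s - q) ` S)"
  have hull: "convex hull ((\<lambda>s. s - q) ` S) = (\<lambda>s. s - q) ` (convex hull S)"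
    using convex_hull_translation[of "- q" S] by simp
  have "q \<notin> ?K"
  proof
    assume "q \<in> ?K"
    then obtain x k where x: "x \<in> convex hull S" and k: "k \<ge> 0" "q = k *\<^sub>R (x - q)"
      using assms(2) by (auto simp: convex_cone_hull_convex_hull_nonempty hull)
    with \<open>q \<noteq> 0\<close> have "k > 0"
      by (cases "k = 0") auto
    \<comment> \<open>Solving \<open>q = k *\<^sub>R (x - q)\<close> for \<open>x\<close> puts a
      point of the hull on the ray strictly beyond \<open>q\<close>, against
      \<open>exit\<close>.\<close>
    have "k *\<^sub>R x = (1 + k) *\<^sub>R q"
      using k(2) by (simp add: algebra_simps)
    then have "(1 / k) *\<^sub>R (k *\<^sub>R x) = (1 / k) *\<^sub>R ((1 + k) *\<^sub>R q)"
      by simp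
    then have "x = ((1 + k) / k) *\<^sub>R q"
      using \<open>k > 0\<close> by simp
    moreover have "(1 + k) / k > 1"
      using \<open>k > 0\<close> by simp
    ultimately show False
      using exit x by blast
  qed
  moreover have "closed ?K"
    using \<open>finite S\<close> by (simp add: closed_convex_cone_hull)
  ultimately obtain a b where ab: "a \<bullet> q < b" "\<And>x. x \<in> ?K \<Longrightarrow> a \<bullet> x > b"
    using separating_hyperplane_closed_point[OF convex_convex_cone_hull] by blast
  have "b < 0"
    using ab(2)[OF convex_cone_hull_contains_0] by simp
  \<comment> \<open>A linear form bounded below on a cone is nonnegative there: if
    \<open>a \<bullet> x < 0\<close>, rescaling \<open>x\<close> by
    \<open>b / (a \<bullet> x)\<close> gives a cone point with value exactly \<open>b\<close>, which
    the strict bound forbids.\<close>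
  have nonneg: "a \<bullet> x \<ge> 0" if "x \<in> ?K" for x
  proof (rule ccontr)
    assume "\<not> a \<bullet> x \<ge> 0"
    then have "(b / (a \<bullet> x)) *\<^sub>R x \<in> ?K"
      using that \<open>b < 0\<close> by (intro convex_cone_hull_mul) (auto simp: divide_nonpos_nonpos)
    from ab(2)[OF this] show False
      using \<open>\<not> a \<bullet> x \<ge> 0\<close> by simp
  qed
  show thesis
  proof
    \<comment> \<open>The separation has \<open>a \<bullet> q < b < 0\<close>, so the outward normal
      is \<open>- a\<close>.\<close>
    show "(- a) \<bullet> q > 0"
      using ab(1) \<open>b < 0\<close> by simp
    fix y assume "y \<in> convex hull S"
    then have "y - q \<in> ?K"
      using convex_hull_subset_convex_cone_hull[of "(\<lambda>s. s - q) ` S"] hull by auto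
    from nonneg[OF this] show "(- a) \<bullet> y \<le> (- a) \<bullet> q"
      by (simp add: inner_diff_right)
  qed
qed

lemma finite_rows [simp]: "finite (rows A)"
  by (simp add: rows_def full_SetCompr_eq)

lemma matrix_vector_mult_nth_row: "(A *v x) $ i = row i A \<bullet> (x :: real ^ 'n)"
  by (simp add: matrix_mult_dot row_def vec_nth_inverse)

lemma row_in_row_hull: "row i A \<in> row_hull A"
  unfolding row_hull_def rows_def by (intro hull_inc) auto

text \<open>For \<open>b \<ge> 0\<close> the halfspace contains the origin, so by convexity it
  contains the hull once it contains the rows. The value \<open>b = 1\<close> serves feasibility,
  \<open>b = 0\<close> recession directions.\<close>

lemma row_hull_le_iff:
  assumes "b \<ge> 0"
  shows "(\<forall>q\<in>row_hull A. x \<bullet> q \<le> b) \<longleftrightarrow> (\<forall>i. (A *v x) $ i \<le> b)"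
proof
  assume "\<forall>q\<in>row_hull A. x \<bullet> q \<le> b"
  then show "\<forall>i. (A *v x) $ i \<le> b"
    using row_in_row_hull by (metis matrix_vector_mult_nth_row inner_commute)
next
  assume "\<forall>i. (A *v x) $ i \<le> b"
  then have "insert 0 (rows A) \<subseteq> {q. x \<bullet> q \<le> b}"
    using assms by (auto simp: rows_def matrix_vector_mult_nth_row inner_commute)
  then have "row_hull A \<subseteq> {q. x \<bullet> q \<le> b}"
    unfolding row_hull_def by (intro hull_minimal convex_halfspace_le)
  then show "\<forall>q\<in>row_hull A. x \<bullet> q \<le> b"
    by auto
qed

lemma primal_feasible_iff_polar:
  "x \<in> primal_feasible A \<longleftrightarrow> (\<forall>q\<in>row_hull A. x \<bullet> q \<le> 1)"
  by (simp add: row_hull_le_iff primal_feasible_def less_eq_vec_def)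

lemma primal_feasible_support:
  assumes "\<forall>q\<in>row_hull A. d \<bullet> q \<le> d \<bullet> p" "d \<bullet> p > 0"
  shows "d /\<^sub>R (d \<bullet> p) \<in> primal_feasible A"
  unfolding primal_feasible_iff_polar using assms by (auto simp: field_simps)

lemma primal_value_le:
  assumes "t > 0" "t *\<^sub>R c \<in> row_hull A" "x \<in> primal_feasible A"
  shows "c \<bullet> x \<le> 1 / t"
proof -
  have "x \<bullet> (t *\<^sub>R c) \<le> 1"
    using assms(2,3) primal_feasible_iff_polar by blast
  then show ?thesis
    using assms(1) by (simp add: field_simps inner_commute)
qed

text \<open>The factor \<open>c \<bullet> d\<close> cancels, so every supporting \<open>d\<close>
  yields the same objective value.\<close>

lemma primal_value_support:
  fixes c d :: "'a::real_inner"
  assumes "d \<bullet> (t *\<^sub>R c) > 0"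
  shows "c \<bullet> (d /\<^sub>R (d \<bullet> (t *\<^sub>R c))) = 1 / t"
  using assms by (auto simp: inner_commute field_simps)

text \<open>Only points strictly beyond \<open>t *\<^sub>R c\<close> have to lie outside the hull,
  so \<open>t\<close> may be \<open>\<rho>\<close> itself or any larger number.\<close>

lemma primal_value_attained:
  fixes A :: "real ^ 'n ^ 'm"
  assumes "t > 0" "c \<noteq> 0" and exit: "\<And>s. s > t \<Longrightarrow> s *\<^sub>R c \<notin> row_hull A"
  obtains x where "x \<in> primal_feasible A" "c \<bullet> x = 1 / t"
proof -
  have "s *\<^sub>R (t *\<^sub>R c) \<notin> convex hull insert 0 (rows A)" if "s > 1" for s
    using exit[of "s * t"] that \<open>t > 0\<close> by (simp add: row_hull_def)
  then obtain d where d: "\<And>y. y \<in> row_hull A \<Longrightarrow> d \<bullet> y \<le> d \<bullet> (t *\<^sub>R c)" "d \<bullet> (t *\<^sub>R c) > 0"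
    using polytope_exit_support[of "insert 0 (rows A)" "t *\<^sub>R c"] assms(1,2)
    unfolding row_hull_def by auto
  show thesis
    by (rule that[OF primal_feasible_support primal_value_support]) (use d in auto)
qed

lemma inner_one_vec: "(1 :: real ^ 'm) \<bullet> u = (\<Sum>i\<in>UNIV. u $ i)"
  by (simp add: inner_vec_def)

lemma transpose_mult_eq_sum_rows:
  "transpose A *v (u :: real ^ 'm) = (\<Sum>i\<in>UNIV. u $ i *\<^sub>R row i A)"
  by (simp add: matrix_mult_sum scalar_mult_eq_scaleR)

text \<open>Pairing \<open>A *v x \<le> 1\<close> with the nonnegative weights \<open>u\<close>
  preserves the inequality, and the rows weighted by \<open>u\<close> add up to
  \<open>c\<close>.\<close>

lemma weak_duality:
  assumes "x \<in> primal_feasible A" "u \<in> dual_feasible A c"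
  shows "c \<bullet> x \<le> 1 \<bullet> u"
proof -
  have c: "c = (\<Sum>i\<in>UNIV. u $ i *\<^sub>R row i A)"
    using assms(2) unfolding dual_feasible_def transpose_mult_eq_sum_rows by simp
  have "c \<bullet> x = (\<Sum>i\<in>UNIV. u $ i * (A *v x) $ i)"
    by (simp add: c inner_sum_left matrix_vector_mult_nth_row)
  also have "\<dots> \<le> (\<Sum>i\<in>UNIV. u $ i * 1)"
    using assms
    by (intro sum_mono mult_left_mono)
      (auto simp: primal_feasible_def dual_feasible_def less_eq_vec_def)
  finally show ?thesis
    by (simp add: inner_one_vec)
qed

text \<open>By weak duality the common value is both an upper bound for the primal and a lower bound
  for the dual.\<close>

lemma primal_dual_optimumI:
  assumes "x \<in> primal_feasible A" "u \<in> dual_feasible A c" "c \<bullet> x = 1 \<bullet> u"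
  shows "primal_dual_optimum A c x u"
  using assms weak_duality[of _ A _ c]
  unfolding primal_dual_optimum_def primal_optimal_def dual_optimal_def by metis

lemma recession_directionI:
  assumes "r \<noteq> 0" "A *v r \<le> 0"
  shows "recession_direction (primal_feasible A) r"
  unfolding recession_direction_def
proof (intro conjI ballI allI impI)
  fix x and t :: real assume x: "x \<in> primal_feasible A" and "t \<ge> 0"
  have "(A *v x) $ i + t * (A *v r) $ i \<le> 1" for i
    using x assms(2) mult_nonneg_nonpos[OF \<open>t \<ge> 0\<close>, of "(A *v r) $ i"]
    by (auto simp: primal_feasible_def less_eq_vec_def intro: order_trans[OF add_mono])
  then show "x + t *\<^sub>R r \<in> primal_feasible A"
    by (simp add: primal_feasible_def less_eq_vec_def matrix_vector_right_distrib
        matrix_vector_mult_scaleR)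
qed fact

theorem theorem1:
  fixes A :: "real ^ 'n ^ 'm" and c :: "real ^ 'n"
  assumes "norm c = 1"
  defines "\<rho> \<equiv> rho_star A c"
  defines "qs \<equiv> \<rho> *\<^sub>R c"
  defines "case1 \<equiv>
      \<rho> > 0
    \<and> is_maximum ((\<lambda>x. c \<bullet> x) ` primal_feasible A) (1 / \<rho>)
    \<and> (\<forall>d. (\<forall>q \<in> row_hull A. d \<bullet> q \<le> d \<bullet> qs) \<and> d \<bullet> qs > 0 \<longrightarrow>
          primal_optimal A c (d /\<^sub>R (d \<bullet> qs))
        \<and> (\<forall>l :: 'm \<Rightarrow> real.
             qs = (\<Sum>i\<in>UNIV. l i *\<^sub>R row i A) \<and> (\<forall>i. l i \<ge> 0) \<and> (\<Sum>i\<in>UNIV. l i) = 1 \<longrightarrow>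
             primal_dual_optimum A c (d /\<^sub>R (d \<bullet> qs)) (\<chi> i. l i / \<rho>)))"
  defines "case2 \<equiv>
      \<rho> = 0
    \<and> \<not> bdd_above ((\<lambda>x. c \<bullet> x) ` primal_feasible A)
    \<and> (\<forall>d. (\<forall>q \<in> row_hull A. d \<bullet> q \<le> 0) \<and> d \<bullet> c > 0 \<longrightarrow>
          recession_direction (primal_feasible A) (d /\<^sub>R (c \<bullet> d))
        \<and> A *v (d /\<^sub>R (c \<bullet> d)) \<le> 0
        \<and> c \<bullet> (d /\<^sub>R (c \<bullet> d)) = 1)"
  shows "(case1 \<and> \<not> case2) \<or> (\<not> case1 \<and> case2)"
proof -
  have "c \<noteq> 0"
    using assms(1) by auto
  then have max: "is_maximum {s. 0 \<le> s \<and> s *\<^sub>R c \<in> row_hull A} \<rho>"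
    unfolding \<rho>_def by (rule rho_star_is_maximum)
  then have \<rho>: "\<rho> \<ge> 0" "qs \<in> row_hull A"
    by (auto simp: is_maximum_def qs_def)
  have exit: "s *\<^sub>R c \<notin> row_hull A" if "s > \<rho>" for s
  proof
    assume "s *\<^sub>R c \<in> row_hull A"
    \<comment> \<open>Maximality speaks of nonnegative multipliers only; here
      \<open>s > \<rho> \<ge> 0\<close>.\<close>
    then have "s \<le> \<rho>"
      using max that \<rho>(1) by (simp add: is_maximum_def)
    then show False
      using that by simp
  qed
  have case1 if "\<rho> > 0"
  proof -
    have le: "c \<bullet> x \<le> 1 / \<rho>" if "x \<in> primal_feasible A" for x
      using primal_value_le[OF \<open>\<rho> > 0\<close> _ that] \<rho>(2) by (simp add: qs_def)
    obtain x where x: "x \<in> primal_feasible A" "c \<bullet> x = 1 / \<rho>"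
      using primal_value_attained[OF \<open>\<rho> > 0\<close> \<open>c \<noteq> 0\<close> exit] by blast
    have "1 / \<rho> \<in> (\<lambda>x. c \<bullet> x) ` primal_feasible A"
      using x by (metis imageI)
    then have "is_maximum ((\<lambda>x. c \<bullet> x) ` primal_feasible A) (1 / \<rho>)"
      using le by (auto simp: is_maximum_def)
    moreover have "primal_optimal A c (d /\<^sub>R (d \<bullet> qs)) \<and>
        (\<forall>l :: 'm \<Rightarrow> real.
           qs = (\<Sum>i\<in>UNIV. l i *\<^sub>R row i A) \<and> (\<forall>i. l i \<ge> 0) \<and> (\<Sum>i\<in>UNIV. l i) = 1 \<longrightarrow>
           primal_dual_optimum A c (d /\<^sub>R (d \<bullet> qs)) (\<chi> i. l i / \<rho>))"
      if d: "\<forall>q\<in>row_hull A. d \<bullet> q \<le> d \<bullet> qs" "d \<bullet> qs > 0" for d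
    proof (intro conjI allI impI; (elim conjE)?)
      let ?x = "d /\<^sub>R (d \<bullet> qs)"
      have feas: "?x \<in> primal_feasible A"
        using d by (rule primal_feasible_support)
      have val: "c \<bullet> ?x = 1 / \<rho>"
        using primal_value_support d(2) unfolding qs_def by blast
      show "primal_optimal A c ?x"
        unfolding primal_optimal_def val using feas le by blast
      fix l :: "'m \<Rightarrow> real"
      assume l: "qs = (\<Sum>i\<in>UNIV. l i *\<^sub>R row i A)" "\<forall>i. l i \<ge> 0" "(\<Sum>i\<in>UNIV. l i) = 1"
      let ?u = "\<chi> i. l i / \<rho>"
      \<comment> \<open>Dividing the convex combination for \<open>\<rho> *\<^sub>R c\<close> by
        \<open>\<rho>\<close> represents \<open>c\<close>; the weights then sum to
        \<open>1 / \<rho>\<close>, the primal value.\<close>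
      have "transpose A *v ?u = (1 / \<rho>) *\<^sub>R qs"
        unfolding transpose_mult_eq_sum_rows l(1) by (simp add: scaleR_sum_right)
      then have "?u \<in> dual_feasible A c"
        using l(2) \<open>\<rho> > 0\<close> by (simp add: dual_feasible_def qs_def less_eq_vec_def)
      moreover have "1 \<bullet> ?u = 1 / \<rho>"
        using l(3) by (simp add: inner_one_vec flip: sum_divide_distrib)
      ultimately show "primal_dual_optimum A c ?x ?u"
        using feas val by (intro primal_dual_optimumI) auto
    qed
    ultimately show ?thesis
      unfolding case1_def using that by blast
  qed
  moreover have case2 if "\<rho> = 0"
  proof -
    have "\<not> bdd_above ((\<lambda>x. c \<bullet> x) ` primal_feasible A)"
    proof
      assume "bdd_above ((\<lambda>x. c \<bullet> x) ` primal_feasible A)"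
      then obtain M where M: "\<And>x. x \<in> primal_feasible A \<Longrightarrow> c \<bullet> x \<le> M"
        unfolding bdd_above_def by auto
      \<comment> \<open>Chosen so that \<open>1 / t\<close> exceeds the supposed bound
        \<open>M\<close>; as \<open>\<rho> = 0\<close>, every point beyond
        \<open>t *\<^sub>R c\<close> with this \<open>t > 0\<close> is outside the hull.\<close>
      define t where "t = 1 / (\<bar>M\<bar> + 1)"
      have "t > 0"
        by (simp add: t_def)
      then obtain x where "x \<in> primal_feasible A" "c \<bullet> x = 1 / t"
        using primal_value_attained[of t c A] \<open>c \<noteq> 0\<close> exit \<open>\<rho> = 0\<close> by (metis less_trans)
      with M[of x] show False
        by (simp add: t_def)
    qed
    moreover have "recession_direction (primal_feasible A) (d /\<^sub>R (c \<bullet> d))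
        \<and> A *v (d /\<^sub>R (c \<bullet> d)) \<le> 0 \<and> c \<bullet> (d /\<^sub>R (c \<bullet> d)) = 1"
      if d: "\<forall>q\<in>row_hull A. d \<bullet> q \<le> 0" "d \<bullet> c > 0" for d
    proof -
      have pos: "c \<bullet> d > 0"
        using d(2) by (simp add: inner_commute)
      have "A *v (d /\<^sub>R (c \<bullet> d)) \<le> 0"
        using d(1) pos
        by (simp add: row_hull_le_iff less_eq_vec_def matrix_vector_mult_scaleR
            divide_le_0_iff mult_le_0_iff)
      moreover have "c \<bullet> (d /\<^sub>R (c \<bullet> d)) = 1"
        using pos by simp
      \<comment> \<open>The normalization to objective value 1 also shows that the direction is
        nonzero.\<close>
      ultimately show ?thesis
        using recession_directionI[of "d /\<^sub>R (c \<bullet> d)" A] by force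
    qed
    ultimately show ?thesis
      unfolding case2_def using that by simp
  qed
  \<comment> \<open>The two cases disagree about \<open>\<rho> > 0\<close>.\<close>
  moreover have "\<not> (case1 \<and> case2)"
    by (simp add: case1_def case2_def)
  ultimately show ?thesis
    using \<rho>(1) by (metis less_eq_real_def)
qed

end
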